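(* Let $a,b\in\mathbb{Q}$ with $a\neq0$, and let $f_n(x)=\frac1a\left((ax+b)^n-b\right)$ for integers $n\ge0$. For any positive integers $m\le n$, the quotient $q_{m,n}(x)$ and the remainder $r_{m,n}(x)$ of the Euclidean division of $f_n(x)$ by $f_m(x)$ in $\mathbb{Q}[x]$ are \[ q_{m,n}(x)=a\sum_{i=1}^k b^{i-1}f_{n-im}(x)+\sum_{i=1}^k b^i,\qquad r_{m,n}(x)=b^kf_{n-km}(x)+\frac{b^{k+1}-b}{a}, \] where $k=\left[\frac nm\right]$.
   Context: $[\cdot]$ is the integer part; $f_0(x)=\frac{1-b}{a}$, and $b^0=1$ (including when $b=0$). *)

theory Defs
  imports Complex_Main "HOL-Computational_Algebra.Polynomial"
begin

definition f :: "rat \<Rightarrow> rat \<Rightarrow> nat \<Rightarrow> rat poly" where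
  "f a b n = smult (1 / a) ([:b, a:] ^ n - [:b:])"

end

(*
  Put p = ax + b. Since p^m acts as b modulo p^m - b, peeling off factors p^m from p^n gives
  p^n = (p^m - b) * (sum over i = 1..k of b^(i-1) p^(n-im)) + b^k p^(n-km) whenever km <= n.
  Subtracting b and dividing by a turns this into a division of f_n by f_m; for k = [n/m] the
  remainder has degree at most n - km < m, so this is the Euclidean division.
*)
theory Submission
  imports Defs
begin

lemma power_telescope:
  fixes p c :: "'a::comm_ring_1"
  assumes "k * m \<le> n"
  shows "p ^ n = (p ^ m - c) * (\<Sum>i=1..k. c ^ (i - 1) * p ^ (n - i * m)) + c ^ k * p ^ (n - k * m)"
  using assms
proof (induction k)
  case 0
  then show ?case by simp
next
  case (Suc k)
  \<comment> \<open>The bound \<open>Suc k * m \<le> n\<close> keeps the natural subtraction exact.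
    Writing the split-off \<open>p ^ m\<close> as \<open>(p ^ m - c) + c\<close> then yields the
    next summand and the new leftover term.\<close>
  have "n - k * m = m + (n - Suc k * m)"
    using Suc.prems by simp
  then have "p ^ (n - k * m) = p ^ m * p ^ (n - Suc k * m)"
    by (simp only: power_add)
  moreover have "p ^ n = (p ^ m - c) * (\<Sum>i=1..k. c ^ (i - 1) * p ^ (n - i * m)) + c ^ k * p ^ (n - k * m)"
    using Suc by simp
  ultimately show ?case
    by (simp add: algebra_simps del: mult_Suc)
qed

lemma smult_f:
  assumes "a \<noteq> 0"
  shows "smult a (f a b n) = [:b, a:] ^ n - [:b:]"
  using assms by (simp add: f_def)

lemma degree_f:
  assumes "a \<noteq> 0" and "1 \<le> m"
  shows "degree (f a b m) = m"
proof -
  have "degree ([:b, a:] ^ m) = m"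
    using assms by (simp add: degree_power_eq)
  \<comment> \<open>Since \<open>m\<close> is positive, subtracting a constant leaves the leading
    term intact.\<close>
  moreover from this have "degree ([:b, a:] ^ m - [:b:]) = degree ([:b, a:] ^ m)"
    using assms degree_add_eq_left[of "- [:b:]" "[:b, a:] ^ m"]
    unfolding diff_conv_add_uminus by simp
  ultimately show ?thesis
    using assms by (simp add: f_def)
qed

text \<open>The \<open>i\<close>-th summand on the left contributes an extra \<open>- b ^ i\<close>,
  which the constant sum cancels; what remains is the cofactor from
  \<open>power_telescope\<close>.\<close>

lemma quotient_eq:
  assumes "a \<noteq> 0"
  shows "smult a (\<Sum>i=1..k. smult (b ^ (i - 1)) (f a b (n - i * m))) + [:\<Sum>i=1..k. b ^ i:]
       = (\<Sum>i=1..k. [:b:] ^ (i - 1) * [:b, a:] ^ (n - i * m))"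
proof -
  have "smult a (smult (b ^ (i - 1)) (f a b (n - i * m))) + [:b ^ i:]
      = [:b:] ^ (i - 1) * [:b, a:] ^ (n - i * m)" if "i \<in> {1..k}" for i
  proof -
    \<comment> \<open>Here \<open>i \<ge> 1\<close> matters, as \<open>i - 1\<close> is
      truncated.\<close>
    have "b ^ i = b ^ (i - 1) * b"
      using that by (simp add: power_eq_if)
    moreover have "smult a (smult (b ^ (i - 1)) (f a b (n - i * m)))
        = smult (b ^ (i - 1)) ([:b, a:] ^ (n - i * m) - [:b:])"
      using smult_f[OF assms] by (metis smult_smult mult.commute)
    ultimately show ?thesis
      by (simp add: poly_const_pow smult_diff_right)
  qed
  then show ?thesis
    using sum_distrib_left[of "[:a:]" "\<lambda>i. smult (b ^ (i - 1)) (f a b (n - i * m))" "{1..k}"]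
    by (simp add: mult.commute[of a] flip: sum_to_poly sum.distrib)
qed

text \<open>The added constant replaces the \<open>- b ^ (k + 1) / a\<close> coming from
  \<open>f\<close> by \<open>- b / a\<close>. This form serves both the division identity and the
  degree bound.\<close>

lemma remainder_eq:
  "smult (b ^ k) (f a b r) + [:(b ^ (k + 1) - b) / a:]
     = smult (1 / a) ([:b:] ^ k * [:b, a:] ^ r - [:b:])"
  by (simp add: f_def poly_const_pow smult_diff_right diff_divide_distrib mult.commute)

theorem proposition3p2:
  fixes a b :: rat and m n k :: nat
  assumes "a \<noteq> 0"
    and "1 \<le> m" and "m \<le> n"
    and "k = n div m"
  shows "f a b n div f a b m =
           smult a (\<Sum>i=1..k. smult (b ^ (i - 1)) (f a b (n - i * m))) + [:\<Sum>i=1..k. b ^ i:]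
       \<and> f a b n mod f a b m =
           smult (b ^ k) (f a b (n - k * m)) + [:(b ^ (k + 1) - b) / a:]"
    (is "_ = ?q \<and> _ = ?r")
proof -
  have km: "k * m \<le> n" and rm: "n - k * m < m"
    using assms by (simp_all add: minus_div_mult_eq_mod)
  let ?S = "\<Sum>i=1..k. [:b:] ^ (i - 1) * [:b, a:] ^ (n - i * m)"
  have "f a b n = smult (1 / a) (([:b, a:] ^ m - [:b:]) * ?S + [:b:] ^ k * [:b, a:] ^ (n - k * m) - [:b:])"
    unfolding f_def using power_telescope[OF km, of "[:b, a:]" "[:b:]"] by simp
  also have "\<dots> = ?q * f a b m + ?r"
    unfolding quotient_eq[OF assms(1)] remainder_eq
    by (simp add: f_def algebra_simps smult_add_right smult_diff_right)
  finally have division: "f a b n = ?q * f a b m + ?r" .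
  have "degree ([:b, a:] ^ (n - k * m)) \<le> n - k * m"
    using degree_power_le[of "[:b, a:]" "n - k * m"] assms(1) by simp
  then have "degree ?r \<le> n - k * m"
    unfolding remainder_eq
    by (intro order.trans[OF degree_smult_le] degree_diff_le) (auto simp: poly_const_pow)
  then have "degree ?r < degree (f a b m)"
    using rm degree_f[OF assms(1,2)] by simp
  \<comment> \<open>The zero polynomial has degree 0, so nothing has smaller degree.\<close>
  moreover from this have "f a b m \<noteq> 0"
    by auto
  ultimately show ?thesis
    unfolding division by (simp only: div_mult_self3 mod_mult_self3 div_poly_less mod_poly_less add_0_right not_False_eq_True simp_thms)
qed

end
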